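(* Let $\mathcal{C}\subseteq\mathcal{B}\subseteq\mathcal{A}$ be unital complex algebras (unital inclusions) with conditional expectations $\psi:\mathcal{A}\to\mathcal{B}$ and $\phi:\mathcal{B}\to\mathcal{C}$, and write $\phi$ also for $\phi\circ\psi:\mathcal{A}\to\mathcal{C}$. Let $C_n^\phi$ be the $n$-th $\mathcal{C}$-valued free cumulant with respect to $\phi:\mathcal{A}\to\mathcal{C}$, and for $\sigma\in NC_n$ let $C_n^\phi\circ C_\sigma^\psi=C_{\hat 1_n}^\phi\circ C_\sigma^\psi$ be the nested cumulant. Then for every $n\ge 1$ and all $X_1,X_2,\dots,X_n\in\mathcal{A}$, $$ C_n^\phi(X_1,X_2,\dots,X_n)=\sum_{\sigma\in NC_n} C_n^\phi\circ C_\sigma^\psi(X_1,X_2,\dots,X_n). $$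
   Context: A conditional expectation $\mathcal{A}\to\mathcal{B}$ onto a unital subalgebra $\mathcal{B}$ is a unital linear $\mathcal{B}$-bimodule map $\psi$, i.e. $\psi(b)=b$ and $\psi(bXb')=b\,\psi(X)\,b'$ for $b,b'\in\mathcal{B}$, $X\in\mathcal{A}$; similarly for $\phi:\mathcal{B}\to\mathcal{C}$. Then $\phi=\phi\circ\psi:\mathcal{A}\to\mathcal{C}$ is a conditional expectation as well, and $\phi\circ\psi=\phi$ on $\mathcal{A}$. Noncrossing partitions. A set partition $\pi$ of $\{1,\dots,n\}$ is noncrossing if there are no $i<j<k<l$ with $i\sim_\pi k$, $j\sim_\pi l$ and $i\not\sim_\pi j$. $NC_n$ is the lattice of noncrossing partitions of $\{1,\dots,n\}$ under refinement order ($\pi\le\sigma$ if every block of $\pi$ is contained in a block of $\sigma$), with largest element $\hat 1_n$ (one block). $\mu$ denotes the Möbius function of $NC_n$: the function on pairs $\pi\le\sigma$ with $\sum_{\pi\le\rho\le\sigma}\mu(\rho,\sigma)=\delta(\pi,\sigma)$ (equal to $1$ if $\pi=\sigma$ and $0$ otherwise). Every noncrossing partition has a block which is an interval, and removing it leaves a noncrossing partition of the remaining (relabelled) points; this makes the recursions below meaningful. Partitioned moments. For a conditional expectation $E:\mathcal{A}\to\mathcal{D}$ (here $E=\phi$, $\mathcal{D}=\mathcal{C}$ or $E=\psi$, $\mathcal{D}=\mathcal{B}$) and $\pi\in NC_n$, define $E_\pi$ recursively: $E_{\hat 1_n}(X_1,\dots,X_n)=E(X_1X_2\cdots X_n)$,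 and if $\pi_j=\{k,k+1,\dots,l\}$ is an interval block of $\pi$ (and $\pi$ has more than one block), then $$E_\pi(X_1,\dots,X_n)=E_{\pi\setminus\{\pi_j\}}(X_1,\dots,X_{k-1},E(X_kX_{k+1}\cdots X_l)X_{l+1},X_{l+2},\dots,X_n),$$ where for $l=n$ the factor $E(X_k\cdots X_n)$ is instead multiplied to the right of the last remaining argument $X_{k-1}$. Free cumulants. $C_\pi^{E}(X_1,\dots,X_n)=\sum_{\sigma\le\pi}E_\sigma(X_1,\dots,X_n)\,\mu(\sigma,\pi)$ (sum over $\sigma\in NC_n$), and $C_n^{E}=C_{\hat 1_n}^{E}$. Nested expectations. For $\pi\le\sigma$ in $NC_n$ define $\phi_\sigma\circ\psi_\pi(X_1,\dots,X_n)\in\mathcal{C}$ recursively: $\phi_{\hat 1_n}\circ\psi_\pi(X_1,\dots,X_n)=\phi(\psi_\pi(X_1,\dots,X_n))$, and if $\sigma_j=\{k+1,\dots,l\}$ is an interval block of $\sigma$ (and $\sigma$ has more than one block) and $\pi|_{\sigma_j}$ is the set of blocks of $\pi$ contained in $\sigma_j$ (a noncrossing partition of $\sigma_j$), then $$\phi_\sigma\circ\psi_\pi(X_1,\dots,X_n)=\phi_{\sigma\setminus\{\sigma_j\}}\circ\psi_{\pi\setminus\pi|_{\sigma_j}}\bigl(X_1,\dots,X_k,\ \phi(\psi_{\pi|_{\sigma_j}}(X_{k+1},\dots,X_l))\,X_{l+1},\ X_{l+2},\dots,X_n\bigr),$$ where for $l=n$ the factor $\phi(\psi_{\pi|_{\sigma_j}}(X_{k+1},\dots,X_n))$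 is instead multiplied to the right of $X_k$. For $\pi\le\sigma$ in $NC_n$ define $$\phi_\sigma\circ C_\pi^\psi(X_1,\dots,X_n)=\sum_{\tau\le\pi}\phi_\sigma\circ\psi_\tau(X_1,\dots,X_n)\,\mu(\tau,\pi).$$ Nested cumulants. For $\pi\le\sigma$ in $NC_n$, $$C_\sigma^\phi\circ C_\pi^\psi(X_1,\dots,X_n)=\sum_{\pi\le\rho\le\sigma}\phi_\rho\circ C_\pi^\psi(X_1,\dots,X_n)\,\mu(\rho,\sigma).$$ The symbols $\phi_\sigma\circ\psi_\pi$, $\phi_\sigma\circ C^\psi_\pi$, $C^\phi_\sigma\circ C^\psi_\pi$ denote the functions so defined (not literal compositions). *)

theory Defs
  imports Complex_Main "HOL-Library.Disjoint_Sets"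
begin

section \<open>Algebras and conditional expectations\<close>

text \<open>The sort \<open>{ring, monoid_mult}\<close> is that of associative unital rings in which \<open>0 = 1\<close> is not
  excluded. The type itself plays the role of the largest algebra.\<close>

locale complex_algebra = vector_space scale
  for scale :: "complex \<Rightarrow> 'a::{ring,monoid_mult} \<Rightarrow> 'a" +
  assumes scale_mult_left: "scale c x * y = scale c (x * y)"
    and scale_mult_right: "x * scale c y = scale c (x * y)"

definition unital_subalgebra :: "(complex \<Rightarrow> 'a::{ring,monoid_mult} \<Rightarrow> 'a) \<Rightarrow> 'a set \<Rightarrow> bool"
  where "unital_subalgebra scale D \<longleftrightarrow>
    module.subspace scale D \<and> 1 \<in> D \<and> (\<forall>x\<in>D. \<forall>y\<in>D. x * y \<in> D)"

text \<open>\<open>conditional_expectation scale A D E\<close>: the restriction of \<open>E\<close> to \<open>A\<close> is a conditional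
  expectation \<open>A \<rightarrow> D\<close>. Values of \<open>E\<close> outside \<open>A\<close> are irrelevant.\<close>

definition conditional_expectation ::
    "(complex \<Rightarrow> 'a::{ring,monoid_mult} \<Rightarrow> 'a) \<Rightarrow> 'a set \<Rightarrow> 'a set \<Rightarrow> ('a \<Rightarrow> 'a) \<Rightarrow> bool"
  where "conditional_expectation scale A D E \<longleftrightarrow>
    D \<subseteq> A \<and> E ` A \<subseteq> D \<and>
    (\<forall>x\<in>A. \<forall>y\<in>A. E (x + y) = E x + E y) \<and>
    (\<forall>c. \<forall>x\<in>A. E (scale c x) = scale c (E x)) \<and>
    (\<forall>d\<in>D. E d = d) \<and>
    (\<forall>d\<in>D. \<forall>d'\<in>D. \<forall>x\<in>A. E (d * x * d') = d * E x * d')"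


section \<open>Noncrossing partitions\<close>

text \<open>Noncrossing partitions of an arbitrary finite set \<open>S\<close> of natural numbers are considered, so
  that no relabelling is needed when blocks are removed; \<open>NC {1..n}\<close> is the usual lattice
  of noncrossing partitions of order \<open>n\<close>, with largest element \<open>{{1..n}}\<close> if \<open>n \<ge> 1\<close>. Its order is
  \<^const>\<open>refines\<close>.\<close>

definition same_block :: "nat set set \<Rightarrow> nat \<Rightarrow> nat \<Rightarrow> bool"
  where "same_block \<pi> i j \<longleftrightarrow> (\<exists>V\<in>\<pi>. i \<in> V \<and> j \<in> V)"

definition noncrossing :: "nat set set \<Rightarrow> bool"
  where "noncrossing \<pi> \<longleftrightarrow>
    \<not> (\<exists>i j k l. i < j \<and> j < k \<and> k < l \<and>
         same_block \<pi> i k \<and> same_block \<pi> j l \<and> \<not> same_block \<pi> i j)"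

definition NC :: "nat set \<Rightarrow> nat set set set"
  where "NC S = {\<pi>. partition_on S \<pi> \<and> noncrossing \<pi>}"

lemma finite_NC: "finite S \<Longrightarrow> finite (NC S)"
  by (rule finite_subset[OF _ finitely_many_partition_on]) (auto simp: NC_def)

definition NC_interval :: "nat set \<Rightarrow> nat set set \<Rightarrow> nat set set \<Rightarrow> nat set set set"
  where "NC_interval S \<pi> \<sigma> = {\<rho> \<in> NC S. refines S \<pi> \<rho> \<and> refines S \<rho> \<sigma>}"

lemma finite_NC_interval: "finite S \<Longrightarrow> finite (NC_interval S \<pi> \<sigma>)"
  by (simp add: NC_interval_def finite_NC)

function moebius :: "nat set \<Rightarrow> nat set set \<Rightarrow> nat set set \<Rightarrow> int"
  where "moebius S \<pi> \<sigma> =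
    (if finite S \<and> \<pi> \<in> NC S \<and> \<sigma> \<in> NC S \<and> refines S \<pi> \<sigma>
     then if \<pi> = \<sigma> then 1 else - (\<Sum>\<rho> \<in> NC_interval S \<pi> \<sigma> - {\<pi>}. moebius S \<rho> \<sigma>)
     else 0)"
  by pat_completeness auto
termination
proof (relation "measure (\<lambda>(S, \<pi>, \<sigma>). card (NC_interval S \<pi> \<sigma>))", goal_cases)
  case 1
  then show ?case by simp
next
  case (2 S \<pi> \<sigma> \<rho>)
  then have \<rho>: "\<rho> \<in> NC S" "refines S \<pi> \<rho>" "refines S \<rho> \<sigma>" "\<rho> \<noteq> \<pi>"
    by (auto simp: NC_interval_def)
  have "NC_interval S \<rho> \<sigma> \<subseteq> NC_interval S \<pi> \<sigma>"
    using \<rho> refines_trans by (fastforce simp: NC_interval_def)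
  moreover have "\<pi> \<in> NC_interval S \<pi> \<sigma>"
    using 2 by (simp add: NC_interval_def NC_def refines_refl)
  moreover have "\<pi> \<notin> NC_interval S \<rho> \<sigma>"
    using \<rho> refines_asym by (auto simp: NC_interval_def)
  ultimately have "NC_interval S \<rho> \<sigma> \<subset> NC_interval S \<pi> \<sigma>" by blast
  then show ?case
    using 2 by (simp add: finite_NC_interval psubset_card_mono)
qed

declare moebius.simps [simp del]

text \<open>The defining property of the Moebius function.\<close>

lemma sum_moebius:
  assumes "finite S" "\<pi> \<in> NC S" "\<sigma> \<in> NC S" "refines S \<pi> \<sigma>"
  shows "(\<Sum>\<rho> \<in> NC_interval S \<pi> \<sigma>. moebius S \<rho> \<sigma>) = (if \<pi> = \<sigma> then 1 else 0)"
proof -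
  have \<pi>: "\<pi> \<in> NC_interval S \<pi> \<sigma>"
    using assms by (simp add: NC_interval_def NC_def refines_refl)
  show ?thesis
  proof (cases "\<pi> = \<sigma>")
    case True
    have "NC_interval S \<pi> \<sigma> = {\<pi>}"
      using \<pi> refines_asym unfolding True NC_interval_def by blast
    then show ?thesis using assms True by (simp add: moebius.simps)
  next
    case False
    then show ?thesis
      using assms \<pi> by (simp add: sum.remove[OF finite_NC_interval] moebius.simps[of S \<pi>])
  qed
qed


section \<open>Partitioned moments and free cumulants\<close>

text \<open>Arguments \<open>(X\<^sub>s)\<^sub>s\<^sub>\<in>\<^sub>S\<close> are given as a function \<open>X\<close> on \<^typ>\<open>nat\<close> of which only the values on
  \<open>S\<close> matter.\<close>

definition ordered_prod :: "nat set \<Rightarrow> (nat \<Rightarrow> 'a::monoid_mult) \<Rightarrow> 'a"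
  where "ordered_prod S X = prod_list (map X (sorted_list_of_set S))"

text \<open>\<open>V\<close> consists of consecutive elements of \<open>S\<close>.\<close>

definition interval_in :: "nat set \<Rightarrow> nat set \<Rightarrow> bool"
  where "interval_in S V \<longleftrightarrow>
    V \<noteq> {} \<and> V \<subseteq> S \<and> (\<forall>i\<in>V. \<forall>k\<in>V. \<forall>j\<in>S. i \<le> j \<and> j \<le> k \<longrightarrow> j \<in> V)"

text \<open>When the arguments indexed by \<open>V\<close> are removed and replaced by the factor \<open>d\<close>, this factor is
  multiplied to the left of the next remaining argument or, if there is none, to the
  right of the last remaining argument.\<close>

definition absorb :: "nat set \<Rightarrow> nat set \<Rightarrow> 'a::times \<Rightarrow> (nat \<Rightarrow> 'a) \<Rightarrow> nat \<Rightarrow> 'a"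
  where "absorb S V d X =
    (if \<exists>s\<in>S. Max V < s
     then let m = Min {s\<in>S. Max V < s} in X(m := d * X m)
     else let m = Max (S - V) in X(m := X m * d))"

text \<open>\<open>moment_rel E S \<pi> X y\<close>: the recursion for the partitioned moment of \<open>X\<close> along the noncrossing
  partition \<open>\<pi>\<close> of \<open>S\<close> yields \<open>y\<close> for some order of removing interval blocks. If \<open>E\<close> is a
  conditional expectation, the result does not depend on the order and the value is given
  by \<open>partitioned_moment\<close>.\<close>

inductive moment_rel ::
    "('a::monoid_mult \<Rightarrow> 'a) \<Rightarrow> nat set \<Rightarrow> nat set set \<Rightarrow> (nat \<Rightarrow> 'a) \<Rightarrow> 'a \<Rightarrow> bool"
  for E
  where
    one_block: "moment_rel E S {S} X (E (ordered_prod S X))"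
  | remove_block: "\<lbrakk>V \<in> \<pi>; \<pi> \<noteq> {V}; interval_in S V;
        moment_rel E (S - V) (\<pi> - {V}) (absorb S V (E (ordered_prod V X)) X) y\<rbrakk>
      \<Longrightarrow> moment_rel E S \<pi> X y"

definition partitioned_moment ::
    "('a::monoid_mult \<Rightarrow> 'a) \<Rightarrow> nat set \<Rightarrow> nat set set \<Rightarrow> (nat \<Rightarrow> 'a) \<Rightarrow> 'a"
  where "partitioned_moment E S \<pi> X = (THE y. moment_rel E S \<pi> X y)"

definition partitioned_cumulant ::
    "(complex \<Rightarrow> 'a::{ring,monoid_mult} \<Rightarrow> 'a) \<Rightarrow> ('a \<Rightarrow> 'a) \<Rightarrow>
     nat set \<Rightarrow> nat set set \<Rightarrow> (nat \<Rightarrow> 'a) \<Rightarrow> 'a"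
  where "partitioned_cumulant scale E S \<pi> X =
    (\<Sum>\<sigma> | \<sigma> \<in> NC S \<and> refines S \<sigma> \<pi>.
       scale (of_int (moebius S \<sigma> \<pi>)) (partitioned_moment E S \<sigma> X))"

definition free_cumulant ::
    "(complex \<Rightarrow> 'a::{ring,monoid_mult} \<Rightarrow> 'a) \<Rightarrow> ('a \<Rightarrow> 'a) \<Rightarrow> nat \<Rightarrow> (nat \<Rightarrow> 'a) \<Rightarrow> 'a"
  where "free_cumulant scale E n X = partitioned_cumulant scale E {1..n} {{1..n}} X"


section \<open>Nested expectations and nested cumulants\<close>

definition blocks_within :: "nat set set \<Rightarrow> nat set \<Rightarrow> nat set set"
  where "blocks_within \<pi> V = {U \<in> \<pi>. U \<subseteq> V}"

text \<open>As for \<^const>\<open>moment_rel\<close>, the result is independent of the order in which the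
  interval blocks of the coarser partition \<open>\<sigma>\<close> are removed.\<close>

inductive nested_rel ::
    "('a::monoid_mult \<Rightarrow> 'a) \<Rightarrow> ('a \<Rightarrow> 'a) \<Rightarrow>
     nat set \<Rightarrow> nat set set \<Rightarrow> nat set set \<Rightarrow> (nat \<Rightarrow> 'a) \<Rightarrow> 'a \<Rightarrow> bool"
  for \<phi> \<psi>
  where
    one_block: "nested_rel \<phi> \<psi> S {S} \<pi> X (\<phi> (partitioned_moment \<psi> S \<pi> X))"
  | remove_block: "\<lbrakk>V \<in> \<sigma>; \<sigma> \<noteq> {V}; interval_in S V;
        nested_rel \<phi> \<psi> (S - V) (\<sigma> - {V}) (\<pi> - blocks_within \<pi> V)
          (absorb S V (\<phi> (partitioned_moment \<psi> V (blocks_within \<pi> V) X)) X) y\<rbrakk>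
      \<Longrightarrow> nested_rel \<phi> \<psi> S \<sigma> \<pi> X y"

text \<open>\<open>\<phi>\<^sub>\<sigma> \<circ> \<psi>\<^sub>\<pi>\<close>\<close>

definition nested_moment ::
    "('a::monoid_mult \<Rightarrow> 'a) \<Rightarrow> ('a \<Rightarrow> 'a) \<Rightarrow>
     nat set \<Rightarrow> nat set set \<Rightarrow> nat set set \<Rightarrow> (nat \<Rightarrow> 'a) \<Rightarrow> 'a"
  where "nested_moment \<phi> \<psi> S \<sigma> \<pi> X = (THE y. nested_rel \<phi> \<psi> S \<sigma> \<pi> X y)"

text \<open>\<open>\<phi>\<^sub>\<sigma> \<circ> C\<^sub>\<pi>\<^sup>\<psi>\<close>\<close>

definition nested_moment_cumulant ::
    "(complex \<Rightarrow> 'a::{ring,monoid_mult} \<Rightarrow> 'a) \<Rightarrow> ('a \<Rightarrow> 'a) \<Rightarrow> ('a \<Rightarrow> 'a) \<Rightarrow>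
     nat set \<Rightarrow> nat set set \<Rightarrow> nat set set \<Rightarrow> (nat \<Rightarrow> 'a) \<Rightarrow> 'a"
  where "nested_moment_cumulant scale \<phi> \<psi> S \<sigma> \<pi> X =
    (\<Sum>\<tau> | \<tau> \<in> NC S \<and> refines S \<tau> \<pi>.
       scale (of_int (moebius S \<tau> \<pi>)) (nested_moment \<phi> \<psi> S \<sigma> \<tau> X))"

text \<open>\<open>C\<^sub>\<sigma>\<^sup>\<phi> \<circ> C\<^sub>\<pi>\<^sup>\<psi>\<close>\<close>

definition nested_cumulant ::
    "(complex \<Rightarrow> 'a::{ring,monoid_mult} \<Rightarrow> 'a) \<Rightarrow> ('a \<Rightarrow> 'a) \<Rightarrow> ('a \<Rightarrow> 'a) \<Rightarrow>
     nat set \<Rightarrow> nat set set \<Rightarrow> nat set set \<Rightarrow> (nat \<Rightarrow> 'a) \<Rightarrow> 'a"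
  where "nested_cumulant scale \<phi> \<psi> S \<sigma> \<pi> X =
    (\<Sum>\<rho> \<in> NC_interval S \<pi> \<sigma>.
       scale (of_int (moebius S \<rho> \<sigma>)) (nested_moment_cumulant scale \<phi> \<psi> S \<rho> \<pi> X))"

end

(* Exchanging the sums over sigma, rho and tau, the sum of mu(tau, sigma) over sigma in
   [tau, rho] collapses the right-hand side to the terms tau = rho; there the nested moments are
   the partitioned moments of the composed expectation, because the two recursions coincide. *)
theory Submission
  imports Defs
begin

lemma NC_interval_self:
  assumes "\<pi> \<in> NC S"
  shows "NC_interval S \<pi> \<pi> = {\<pi>}"
proof -
  have "refines S \<pi> \<pi>"
    using assms by (simp add: NC_def refines_refl)
  then show ?thesis
    using assms refines_asym unfolding NC_interval_def by blast
qed

text \<open>By antisymmetry of refinement the top \<open>\<sigma>\<close> lies only in the larger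
  interval. This is the decrease that drives the induction on upper endpoints in
  \<open>sum_moebius_right\<close>.\<close>

lemma NC_interval_psubset:
  assumes "\<rho> \<in> NC_interval S \<pi> \<sigma>" "\<rho> \<noteq> \<sigma>" "\<sigma> \<in> NC S" "refines S \<pi> \<sigma>"
  shows "NC_interval S \<pi> \<rho> \<subset> NC_interval S \<pi> \<sigma>"
proof -
  have "refines S \<sigma> \<sigma>"
    using assms by (simp add: NC_def refines_refl)
  moreover have "\<not> refines S \<sigma> \<rho>"
    using assms refines_asym unfolding NC_interval_def by blast
  ultimately have "\<sigma> \<in> NC_interval S \<pi> \<sigma>" "\<sigma> \<notin> NC_interval S \<pi> \<rho>"
    using assms by (simp_all add: NC_interval_def)
  moreover have "NC_interval S \<pi> \<rho> \<subseteq> NC_interval S \<pi> \<sigma>"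
    using assms(1) by (auto simp: NC_interval_def intro: refines_trans)
  ultimately show ?thesis by blast
qed

text \<open>Since \<^const>\<open>moebius\<close> is a right inverse of the zeta function in the incidence algebra,
  associativity gives \<open>f * \<mu> = \<mu>\<close> for \<open>f = \<mu> * \<zeta>\<close>; this determines \<open>f\<close> by induction on the
  length of the interval.\<close>

lemma sum_moebius_right:
  assumes S: "finite S" and \<pi>: "\<pi> \<in> NC S"
    and "\<sigma> \<in> NC S" "refines S \<pi> \<sigma>"
  shows "(\<Sum>\<rho> \<in> NC_interval S \<pi> \<sigma>. moebius S \<pi> \<rho>) = (if \<pi> = \<sigma> then 1 else 0)"
  using assms(3,4)
proof (induction "card (NC_interval S \<pi> \<sigma>)" arbitrary: \<sigma> rule: less_induct)
  case less
  let ?f = "\<lambda>\<rho>. \<Sum>\<kappa> \<in> NC_interval S \<pi> \<rho>. moebius S \<pi> \<kappa>"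
  let ?I = "NC_interval S \<pi> \<sigma>"
  have fin: "finite ?I"
    by (simp add: S finite_NC_interval)
  have \<pi>I: "\<pi> \<in> ?I" and \<sigma>I: "\<sigma> \<in> ?I"
    using \<pi> less.prems by (simp_all add: NC_interval_def NC_def refines_refl)
  show ?case
  proof (cases "\<pi> = \<sigma>")
    case True
    have "moebius S \<sigma> \<sigma> = 1"
      using S less.prems by (simp add: moebius.simps NC_def refines_refl)
    then show ?thesis
      using True less.prems by (simp add: NC_interval_self)
  next
    case False
    \<comment> \<open>Both kinds of subinterval are cut out of \<open>?I\<close> by one relation,
      which is the form in which the double sum can be exchanged.\<close>
    have lower: "NC_interval S \<pi> \<rho> = {\<kappa> \<in> ?I. refines S \<kappa> \<rho>}"
      if "\<rho> \<in> ?I" for \<rho>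
      using that refines_trans by (fastforce simp: NC_interval_def)
    have upper: "NC_interval S \<kappa> \<sigma> = {\<rho> \<in> ?I. refines S \<kappa> \<rho>}"
      if "\<kappa> \<in> ?I" for \<kappa>
      using that refines_trans by (fastforce simp: NC_interval_def)
    \<comment> \<open>Associativity: both bracketings sum over chains \<pi> \<le> \<kappa> \<le>
      \<rho> \<le> \<sigma>. Summing over \<rho> first invokes the defining property
      \<open>sum_moebius\<close>, which leaves only \<kappa> = \<sigma>.\<close>
    have "(\<Sum>\<rho>\<in>?I. ?f \<rho> * moebius S \<rho> \<sigma>)
        = (\<Sum>\<rho>\<in>?I. \<Sum>\<kappa> | \<kappa> \<in> ?I \<and> refines S \<kappa> \<rho>. moebius S \<pi> \<kappa> * moebius S \<rho> \<sigma>)"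
      by (simp add: lower sum_distrib_right)
    also have "\<dots> = (\<Sum>\<kappa>\<in>?I. \<Sum>\<rho> | \<rho> \<in> ?I \<and> refines S \<kappa> \<rho>. moebius S \<pi> \<kappa> * moebius S \<rho> \<sigma>)"
      by (rule sum.swap_restrict[OF fin fin])
    also have "\<dots> = (\<Sum>\<kappa>\<in>?I. moebius S \<pi> \<kappa> * (\<Sum>\<rho> \<in> NC_interval S \<kappa> \<sigma>. moebius S \<rho> \<sigma>))"
      by (simp add: upper sum_distrib_left)
    also have "\<dots> = (\<Sum>\<kappa>\<in>?I. moebius S \<pi> \<kappa> * (if \<kappa> = \<sigma> then 1 else 0))"
    proof (intro sum.cong refl arg_cong2[of _ _ _ _ times] sum_moebius)
      fix \<kappa> assume "\<kappa> \<in> ?I"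
      then show "\<kappa> \<in> NC S" "refines S \<kappa> \<sigma>"
        by (simp_all add: NC_interval_def)
    qed (use S less.prems in auto)
    also have "\<dots> = moebius S \<pi> \<sigma>"
      using fin \<sigma>I by (simp add: if_distrib[of "\<lambda>z. _ * z"] cong: if_cong)
    finally have f_moebius: "(\<Sum>\<rho>\<in>?I. ?f \<rho> * moebius S \<rho> \<sigma>) = moebius S \<pi> \<sigma>" .
    have IH: "?f \<rho> = (if \<pi> = \<rho> then 1 else 0)" if "\<rho> \<in> ?I - {\<sigma>}" for \<rho>
    proof (rule less.hyps)
      show "card (NC_interval S \<pi> \<rho>) < card ?I"
        using that less.prems fin by (intro psubset_card_mono NC_interval_psubset) auto
      show "\<rho> \<in> NC S" "refines S \<pi> \<rho>"
        using that by (simp_all add: NC_interval_def)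
    qed
    \<comment> \<open>The only unknown is \<open>?f \<sigma>\<close>, with coefficient 1. Among the
      other terms only \<rho> = \<pi> survives, and it already accounts for the whole value in
      \<open>f_moebius\<close>, so \<open>?f \<sigma>\<close> is 0.\<close>
    have "(\<Sum>\<rho>\<in>?I. ?f \<rho> * moebius S \<rho> \<sigma>)
        = ?f \<sigma> * moebius S \<sigma> \<sigma> + (\<Sum>\<rho>\<in>?I - {\<sigma>}. ?f \<rho> * moebius S \<rho> \<sigma>)"
      by (rule sum.remove[OF fin \<sigma>I])
    also have "(\<Sum>\<rho>\<in>?I - {\<sigma>}. ?f \<rho> * moebius S \<rho> \<sigma>)
        = (\<Sum>\<rho>\<in>?I - {\<sigma>}. if \<pi> = \<rho> then moebius S \<rho> \<sigma> else 0)"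
      by (rule sum.cong[OF refl], simp only: IH) simp
    also have "\<dots> = moebius S \<pi> \<sigma>"
      using fin \<pi>I False by simp
    also have "moebius S \<sigma> \<sigma> = 1"
      using S less.prems by (simp add: moebius.simps NC_def refines_refl)
    finally show ?thesis
      using f_moebius False by simp
  qed
qed

text \<open>The rule \<open>remove_block\<close> excludes a partition whose only block is the
  removed one, so \<open>one_block\<close> alone applies and the definite description has a unique
  candidate.\<close>

lemma partitioned_moment_one_block:
  "partitioned_moment E S {S} X = E (ordered_prod S X)"
proof -
  have "moment_rel E S {S} X y \<longleftrightarrow> y = E (ordered_prod S X)" for y
    by (subst moment_rel.simps) auto
  then show ?thesis
    by (simp add: partitioned_moment_def)
qed

lemma blocks_within_block:
  assumes "disjoint \<pi>" "{} \<notin> \<pi>" "V \<in> \<pi>"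
  shows "blocks_within \<pi> V = {V}"
proof -
  have "U = V" if "U \<in> \<pi>" "U \<subseteq> V" for U
  proof (rule ccontr)
    assume "U \<noteq> V"
    then have "U \<inter> V = {}"
      using assms that by (meson disjointD)
    then show False
      using assms that by (metis inf.absorb1)
  qed
  then show ?thesis
    using assms by (auto simp: blocks_within_def)
qed

text \<open>On the diagonal each removed block \<open>V\<close> carries the inner partition
  \<open>{V}\<close>, so the absorbed factor is \<phi>(\<psi>(...)) of the product over
  \<open>V\<close>, exactly as in the recursion for the composed expectation. The equation
  \<open>\<pi> = \<sigma>\<close> is a separate premise because rule induction varies both
  partitions.\<close>

lemma nested_rel_diagonal_imp:
  assumes "nested_rel \<phi> \<psi> S \<sigma> \<pi> X y" "\<pi> = \<sigma>" "disjoint \<sigma>" "{} \<notin> \<sigma>"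
  shows "moment_rel (\<lambda>x. \<phi> (\<psi> x)) S \<sigma> X y"
  using assms
proof (induction rule: nested_rel.induct)
  case (one_block S \<pi> X)
  then show ?case
    using moment_rel.one_block[of "\<lambda>x. \<phi> (\<psi> x)" S X] by (simp add: partitioned_moment_one_block)
next
  case (remove_block V \<sigma> S \<pi> X y)
  have V: "blocks_within \<sigma> V = {V}"
    using remove_block by (simp add: blocks_within_block)
  have "disjoint (\<sigma> - {V})"
    using \<open>disjoint \<sigma>\<close> by (rule pairwise_subset) auto
  then have "moment_rel (\<lambda>x. \<phi> (\<psi> x)) (S - V) (\<sigma> - {V})
      (absorb S V (\<phi> (\<psi> (ordered_prod V X))) X) y"
    using remove_block.IH remove_block.prems by (simp add: V partitioned_moment_one_block)
  with remove_block.hyps(1-3) show ?case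
    by (rule moment_rel.remove_block)
qed

lemma moment_rel_imp_nested_rel:
  assumes "moment_rel (\<lambda>x. \<phi> (\<psi> x)) S \<sigma> X y" "disjoint \<sigma>" "{} \<notin> \<sigma>"
  shows "nested_rel \<phi> \<psi> S \<sigma> \<sigma> X y"
  using assms
proof (induction rule: moment_rel.induct)
  case (one_block S X)
  show ?case
    using nested_rel.one_block[of \<phi> \<psi> S "{S}" X] by (simp add: partitioned_moment_one_block)
next
  case (remove_block V \<sigma> S X y)
  have V: "blocks_within \<sigma> V = {V}"
    using remove_block by (simp add: blocks_within_block)
  have "disjoint (\<sigma> - {V})"
    using \<open>disjoint \<sigma>\<close> by (rule pairwise_subset) auto
  \<comment> \<open>Stated with \<open>blocks_within\<close> unevaluated, to match the premise of
    the introduction rule.\<close>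
  then have "nested_rel \<phi> \<psi> (S - V) (\<sigma> - {V}) (\<sigma> - blocks_within \<sigma> V)
      (absorb S V (\<phi> (partitioned_moment \<psi> V (blocks_within \<sigma> V) X)) X) y"
    using remove_block.IH remove_block.prems by (simp add: V partitioned_moment_one_block)
  with remove_block.hyps(1-3) show ?case
    by (rule nested_rel.remove_block)
qed

text \<open>The two implications above make both recursions the same predicate of \<open>y\<close>,
  so their definite descriptions coincide.\<close>

lemma nested_moment_diagonal:
  assumes "partition_on S \<sigma>"
  shows "nested_moment \<phi> \<psi> S \<sigma> \<sigma> X = partitioned_moment (\<phi> \<circ> \<psi>) S \<sigma> X"
proof -
  have "nested_rel \<phi> \<psi> S \<sigma> \<sigma> X y \<longleftrightarrow> moment_rel (\<lambda>x. \<phi> (\<psi> x)) S \<sigma> X y" for y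
    using assms nested_rel_diagonal_imp moment_rel_imp_nested_rel
    unfolding partition_on_def by blast
  then show ?thesis
    by (simp add: nested_moment_def partitioned_moment_def comp_def)
qed

text \<open>Moebius inversion in the inner partition. The coefficient of the nested moment at \<tau>
  sums the Moebius function over its second argument, which is why \<open>sum_moebius_right\<close>
  is used and not \<open>sum_moebius\<close>.\<close>

lemma (in complex_algebra) sum_nested_moment_cumulant:
  assumes S: "finite S" and \<rho>: "\<rho> \<in> NC S"
  shows "(\<Sum>\<sigma> | \<sigma> \<in> NC S \<and> refines S \<sigma> \<rho>. nested_moment_cumulant scale \<phi> \<psi> S \<rho> \<sigma> X)
    = partitioned_moment (\<phi> \<circ> \<psi>) S \<rho> X"
proof -
  let ?L = "{\<sigma> \<in> NC S. refines S \<sigma> \<rho>}"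
  let ?g = "\<lambda>\<tau>. nested_moment \<phi> \<psi> S \<rho> \<tau> X"
  have fin: "finite ?L"
    by (simp add: S finite_NC)
  have \<rho>L: "\<rho> \<in> ?L"
    using \<rho> by (simp add: NC_def refines_refl)
  \<comment> \<open>By transitivity both summation variables range over \<open>?L\<close>, as the
    exchange requires.\<close>
  have lower: "{\<tau> \<in> NC S. refines S \<tau> \<sigma>} = {\<tau> \<in> ?L. refines S \<tau> \<sigma>}" if "\<sigma> \<in> ?L" for \<sigma>
    using that refines_trans by fastforce
  have upper: "{\<sigma> \<in> ?L. refines S \<tau> \<sigma>} = NC_interval S \<tau> \<rho>" for \<tau>
    by (auto simp: NC_interval_def)
  have "(\<Sum>\<sigma>\<in>?L. nested_moment_cumulant scale \<phi> \<psi> S \<rho> \<sigma> X)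
      = (\<Sum>\<sigma>\<in>?L. \<Sum>\<tau> | \<tau> \<in> ?L \<and> refines S \<tau> \<sigma>. scale (of_int (moebius S \<tau> \<sigma>)) (?g \<tau>))"
    unfolding nested_moment_cumulant_def by (intro sum.cong refl lower)
  also have "\<dots> = (\<Sum>\<tau>\<in>?L. \<Sum>\<sigma> | \<sigma> \<in> ?L \<and> refines S \<tau> \<sigma>. scale (of_int (moebius S \<tau> \<sigma>)) (?g \<tau>))"
    by (rule sum.swap_restrict[OF fin fin])
  also have "\<dots> = (\<Sum>\<tau>\<in>?L. scale (of_int (\<Sum>\<sigma>\<in>NC_interval S \<tau> \<rho>. moebius S \<tau> \<sigma>)) (?g \<tau>))"
    by (simp only: upper of_int_sum scale_sum_left)
  also have "\<dots> = (\<Sum>\<tau>\<in>?L. if \<tau> = \<rho> then ?g \<tau> else 0)"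
    using S \<rho> by (intro sum.cong refl) (simp add: sum_moebius_right)
  also have "\<dots> = ?g \<rho>"
    using fin \<rho>L by simp
  finally show ?thesis
    using \<rho> by (simp add: nested_moment_diagonal NC_def)
qed

text \<open>The outer weights do not depend on \<pi>. After the exchange the inner sum is therefore
  the preceding lemma, and what remains is the defining sum of the cumulant of the composed
  expectation.\<close>

lemma (in complex_algebra) sum_nested_cumulant:
  assumes S: "finite S"
  shows "(\<Sum>\<pi> | \<pi> \<in> NC S \<and> refines S \<pi> \<sigma>. nested_cumulant scale \<phi> \<psi> S \<sigma> \<pi> X)
    = partitioned_cumulant scale (\<phi> \<circ> \<psi>) S \<sigma> X"
proof -
  let ?L = "{\<pi> \<in> NC S. refines S \<pi> \<sigma>}"
  let ?m = "\<lambda>\<rho>. of_int (moebius S \<rho> \<sigma>)"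
  let ?h = "\<lambda>\<rho> \<pi>. nested_moment_cumulant scale \<phi> \<psi> S \<rho> \<pi> X"
  have fin: "finite ?L"
    by (simp add: S finite_NC)
  have upper: "NC_interval S \<pi> \<sigma> = {\<rho> \<in> ?L. refines S \<pi> \<rho>}" for \<pi>
    by (auto simp: NC_interval_def)
  have lower: "{\<pi> \<in> ?L. refines S \<pi> \<rho>} = {\<pi> \<in> NC S. refines S \<pi> \<rho>}" if "\<rho> \<in> ?L" for \<rho>
    using that refines_trans by fastforce
  have "(\<Sum>\<pi>\<in>?L. nested_cumulant scale \<phi> \<psi> S \<sigma> \<pi> X)
      = (\<Sum>\<pi>\<in>?L. \<Sum>\<rho> | \<rho> \<in> ?L \<and> refines S \<pi> \<rho>. scale (?m \<rho>) (?h \<rho> \<pi>))"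
    by (simp only: nested_cumulant_def upper)
  also have "\<dots> = (\<Sum>\<rho>\<in>?L. \<Sum>\<pi> | \<pi> \<in> ?L \<and> refines S \<pi> \<rho>. scale (?m \<rho>) (?h \<rho> \<pi>))"
    by (rule sum.swap_restrict[OF fin fin])
  also have "\<dots> = (\<Sum>\<rho>\<in>?L. scale (?m \<rho>) (\<Sum>\<pi> | \<pi> \<in> NC S \<and> refines S \<pi> \<rho>. ?h \<rho> \<pi>))"
    by (intro sum.cong refl) (simp only: lower scale_sum_right)
  also have "\<dots> = partitioned_cumulant scale (\<phi> \<circ> \<psi>) S \<sigma> X"
    unfolding partitioned_cumulant_def
    using S by (intro sum.cong refl) (simp add: sum_nested_moment_cumulant)
  finally show ?thesis .
qed

theorem theorem3p7:
  fixes scale :: "complex \<Rightarrow> 'a::{ring,monoid_mult} \<Rightarrow> 'a"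
    and B C :: "'a set"
    and \<psi> \<phi> :: "'a \<Rightarrow> 'a"
    and n :: nat
    and X :: "nat \<Rightarrow> 'a"
  assumes "complex_algebra scale"
    and "unital_subalgebra scale B"
    and "unital_subalgebra scale C"
    and "C \<subseteq> B"
    and "conditional_expectation scale UNIV B \<psi>"
    and "conditional_expectation scale B C \<phi>"
    and "n \<ge> 1"
  shows "free_cumulant scale (\<phi> \<circ> \<psi>) n X =
    (\<Sum>\<sigma> \<in> NC {1..n}. nested_cumulant scale \<phi> \<psi> {1..n} {{1..n}} \<sigma> X)"
proof -
  interpret complex_algebra scale by fact
  \<comment> \<open>For n \<ge> 1 the single block is nonempty, so \<open>{{1..n}}\<close> is the
    top of the lattice and every noncrossing partition refines it. For n = 0 it would be
    \<open>{{}}\<close>, which is not a partition.\<close>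
  have "partition_on {1..n} {{1..n}}"
    using \<open>n \<ge> 1\<close> by (intro partition_on_space) auto
  then have "{\<sigma> \<in> NC {1..n}. refines {1..n} \<sigma> {{1..n}}} = NC {1..n}"
    by (auto simp: NC_def refines_def partition_on_def)
  then show ?thesis
    using sum_nested_cumulant[where S = "{1..n}" and \<sigma> = "{{1..n}}"]
    by (simp add: free_cumulant_def)
qed

end
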